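(* Let $m\geq 1$, $b\geq 2$ be integers and $\underline{\theta}_0,\underline{\theta}_1\in\mathbb{R}^m$. Let $w\in(0,1)$ and $w'=(1-\sqrt{w})^2=w+1-2\sqrt{w}$. Then for any real $w_0,w_1$ with $0\leq w_0<w$ and $0\leq w_1<w'$, \[ \mathcal{S}^{(b)}_{m,\underline{\theta}_0}(w_0)+\mathcal{S}^{(b)}_{m,\underline{\theta}_1}(w_1)=\mathcal{S}_{m,\underline{\theta}_0}(w_0)+\mathcal{S}_{m,\underline{\theta}_1}(w_1)=\mathbb{R}^m . \] Moreover, for any countable union $\mathcal{T}$ of affine hyperplanes in $\mathbb{R}^m$, the sets \[ \big(\mathcal{S}^{(b)}_{m,\underline{\theta}_0}(w_0)\setminus\mathcal{T}\big)+\big(\mathcal{S}^{(b)}_{m,\underline{\theta}_1}(w_1)\setminus\mathcal{T}\big),\qquad \big(\mathcal{S}_{m,\underline{\theta}_0}(w_0)\setminus\mathcal{T}\big)+\big(\mathcal{S}_{m,\underline{\theta}_1}(w_1)\setminus\mathcal{T}\big) \] have full $m$-dimensional Lebesgue measure.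
   Context: Fix an arbitrary norm $\Vert\cdot\Vert$ on $\mathbb{R}^m$. For $\underline{\theta}\in\mathbb{R}^m$ and $w\geq 0$, $\mathcal{S}_{m,\underline{\theta}}(w)$ is the set of $\underline{x}\in\mathbb{R}^m$ such that for every $c>0$ there is $Q_0$ such that for all $Q\geq Q_0$ the system $1\leq q\leq Q$, $\Vert q\underline{x}-\underline{p}-\underline{\theta}\Vert\leq cQ^{-w}$ has a solution in integers $q\in\mathbb{Z}$, $\underline{p}\in\mathbb{Z}^m$. The $b$-ary set $\mathcal{S}^{(b)}_{m,\underline{\theta}}(w)$ is defined the same way except that $q$ is restricted to powers $q=b^N$ with $N$ a positive integer. $A+B=\{a+b:a\in A,b\in B\}$. *)

theory Defs
  imports "HOL-Analysis.Analysis" "HOL-Library.Set_Algebras"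
begin

definition is_norm :: "('a::real_vector \<Rightarrow> real) \<Rightarrow> bool" where
  "is_norm \<nu> \<longleftrightarrow>
     (\<forall>x. 0 \<le> \<nu> x) \<and>
     (\<forall>x. \<nu> x = 0 \<longleftrightarrow> x = 0) \<and>
     (\<forall>a x. \<nu> (a *\<^sub>R x) = \<bar>a\<bar> * \<nu> x) \<and>
     (\<forall>x y. \<nu> (x + y) \<le> \<nu> x + \<nu> y)"

definition int_vec :: "int ^ 'm \<Rightarrow> real ^ 'm" where
  "int_vec p = (\<chi> i. real_of_int (p $ i))"

text \<open>
  The sets depend on a norm \<open>\<nu>\<close> on \<open>real ^ 'm\<close>, the dimension being \<open>CARD('m)\<close>.
  The parameter \<open>Q\<close> ranges over the reals. The value of \<open>Q powr (- w)\<close> at \<open>Q \<le> 0\<close>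
  is immaterial: the condition \<open>1 \<le> q \<le> Q\<close> has no solution there.
\<close>

definition unif_approx :: "(real ^ 'm \<Rightarrow> real) \<Rightarrow> real ^ 'm \<Rightarrow> real \<Rightarrow> (real ^ 'm) set" where
  "unif_approx \<nu> \<theta> w =
     {x. \<forall>c>0. \<exists>Q\<^sub>0::real. \<forall>Q\<ge>Q\<^sub>0. \<exists>(q::int) (p::int ^ 'm).
           1 \<le> q \<and> real_of_int q \<le> Q \<and>
           \<nu> (real_of_int q *\<^sub>R x - int_vec p - \<theta>) \<le> c * Q powr (- w)}"

definition unif_approx_base ::
    "nat \<Rightarrow> (real ^ 'm \<Rightarrow> real) \<Rightarrow> real ^ 'm \<Rightarrow> real \<Rightarrow> (real ^ 'm) set" where
  "unif_approx_base b \<nu> \<theta> w =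
     {x. \<forall>c>0. \<exists>Q\<^sub>0::real. \<forall>Q\<ge>Q\<^sub>0. \<exists>(q::int) (p::int ^ 'm).
           (\<exists>N::nat. 1 \<le> N \<and> q = int b ^ N) \<and>
           1 \<le> q \<and> real_of_int q \<le> Q \<and>
           \<nu> (real_of_int q *\<^sub>R x - int_vec p - \<theta>) \<le> c * Q powr (- w)}"

definition affine_hyperplane :: "('a::euclidean_space) set \<Rightarrow> bool" where
  "affine_hyperplane H \<longleftrightarrow> (\<exists>a d. a \<noteq> 0 \<and> H = {x. a \<bullet> x = d})"

text \<open>Since \<^const>\<open>lebesgue\<close> is complete, this entails that the set itself is measurable.\<close>

definition full_lebesgue_measure :: "('a::euclidean_space) set \<Rightarrow> bool" where
  "full_lebesgue_measure A \<longleftrightarrow> - A \<in> null_sets lebesgue"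

end

theory Submission
  imports Defs
begin

text \<open>
  Put \<open>s = \<surd>w\<close>, \<open>t = 1 - s\<close>, \<open>r = 1 / (s t)\<close>, and let the exponents \<open>N\<^sub>k \<approx> r\<^sup>k\<close> and
  \<open>M\<^sub>k \<approx> r\<^sup>k / t\<close> interleave. If \<open>b\<close> to the power \<open>N\<^sub>k\<close> brings \<open>x\<close> close to
  \<open>\<theta>\<^sub>0\<close> modulo 1 by prescribing only the digits of \<open>x\<close> between the positions \<open>N\<^sub>k\<close> and \<open>M\<^sub>k\<close>,
  the error is about \<open>b\<close> to the power \<open>N\<^sub>k - M\<^sub>k \<approx> - w N\<^sub>k\<^sub>+\<^sub>1\<close>. Prescribing the digits of \<open>z - x\<close>
  between \<open>M\<^sub>k\<close> and \<open>N\<^sub>k\<^sub>+\<^sub>1\<close> gives in the same way an error whose exponent is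
  \<open>M\<^sub>k - N\<^sub>k\<^sub>+\<^sub>1 \<approx> - w' M\<^sub>k\<^sub>+\<^sub>1\<close>. The two sets of positions are disjoint, so both conditions can be met
  for every \<open>z\<close>. To avoid carries, \<open>x\<close> is built as a limit, where each step moves to a
  point of a shifted lattice. Two neighbouring lattice points are always available, one of which
  is far enough from a given hyperplane for the limit to avoid it. Hence even the sums of the sets with
  the hyperplanes removed are the whole space.
\<close>

section \<open>Preliminaries on norms and limits\<close>

text \<open>Expansion in the standard basis and the triangle inequality give the sum of the norms of
  the basis vectors as a constant. This is how the arbitrary norm enters; all approximations are
  constructed coordinatewise.\<close>

lemma is_norm_bounded_by_components:
  fixes \<nu> :: "real ^ 'm \<Rightarrow> real"
  assumes "is_norm \<nu>"
  obtains D where "D > 0" and "\<And>v e. (\<And>i. \<bar>v $ i\<bar> \<le> e) \<Longrightarrow> \<nu> v \<le> D * e"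
proof -
  have tri: "\<nu> (x + y) \<le> \<nu> x + \<nu> y" and scale: "\<nu> (a *\<^sub>R x) = \<bar>a\<bar> * \<nu> x"
    and nonneg: "0 \<le> \<nu> x" for a x y
    using assms by (auto simp: is_norm_def)
  have zero: "\<nu> 0 = 0"
    using assms by (auto simp: is_norm_def)
  have sum_le: "\<nu> (sum f S) \<le> (\<Sum>i\<in>S. \<nu> (f i))" if "finite S" for f :: "'m \<Rightarrow> real ^ 'm" and S
    using that
  proof (induction S rule: finite_induct)
    case (insert a S)
    then show ?case
      using tri[of "f a" "sum f S"] by simp
  qed (simp add: zero)
  define D where "D = 1 + (\<Sum>i\<in>UNIV. \<nu> (axis i 1))"
  show ?thesis
  proof
    show "D > 0"
      unfolding D_def using sum_nonneg[of UNIV "\<lambda>i. \<nu> (axis i 1)"] nonneg by (smt (verit))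
    fix v :: "real ^ 'm" and e :: real
    assume le: "\<And>i. \<bar>v $ i\<bar> \<le> e"
    then have "0 \<le> e"
      using abs_ge_zero order_trans by blast
    have "\<nu> v = \<nu> (\<Sum>i\<in>UNIV. (v $ i) *\<^sub>R axis i 1)"
      using basis_expansion[of v] by (simp add: scalar_mult_eq_scaleR)
    also have "\<dots> \<le> (\<Sum>i\<in>UNIV. \<bar>v $ i\<bar> * \<nu> (axis i 1))"
      using sum_le[of UNIV "\<lambda>i. (v $ i) *\<^sub>R axis i 1"] by (simp add: scale)
    also have "\<dots> \<le> (\<Sum>i\<in>UNIV. e * \<nu> (axis i 1))"
      by (intro sum_mono mult_right_mono le nonneg)
    also have "\<dots> \<le> D * e"
      using \<open>0 \<le> e\<close> by (simp add: D_def sum_distrib_left algebra_simps)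
    finally show "\<nu> v \<le> D * e" .
  qed
qed

lemma limit_of_halving_increments:
  fixes u e :: "nat \<Rightarrow> real"
  assumes step: "\<And>j. \<bar>u (Suc j) - u j\<bar> \<le> 2 * e j" and half: "\<And>j. e (Suc j) \<le> e j / 2"
  obtains L where "\<And>j. \<bar>L - u j\<bar> \<le> 4 * e j"
proof -
  have e_nonneg: "0 \<le> e j" for j
    using step[of j] by linarith
  \<comment> \<open>The subtracted term makes the induction close: by \<open>half\<close>, an
    increment of at most \<open>2 * e i\<close> is at most \<open>4 * e i - 4 * e (Suc i)\<close>,
    so the bounds telescope.\<close>
  have close: "\<bar>u (j + n) - u j\<bar> \<le> 4 * e j - 4 * e (j + n)" for j n
  proof (induction n)
    case (Suc n)
    then show ?case
      using step[of "j + n"] half[of "j + n"] by simp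
  qed simp
  have e_le: "e j \<le> e 0 * (1 / 2) ^ j" for j
  proof (induction j)
    case (Suc j)
    then show ?case
      using half[of j] by simp
  qed simp
  have "summable (\<lambda>j. u (Suc j) - u j)"
  proof (rule summable_comparison_test')
    show "summable (\<lambda>j. 2 * e 0 * (1 / 2) ^ j)"
      by (intro summable_mult summable_geometric) simp
    show "norm (u (Suc j) - u j) \<le> 2 * e 0 * (1 / 2) ^ j" for j
      using step[of j] e_le[of j] by simp
  qed
  then have "(\<lambda>n. u n - u 0) \<longlonglongrightarrow> (\<Sum>j. u (Suc j) - u j)"
    using summable_LIMSEQ[of "\<lambda>j. u (Suc j) - u j"] by (simp add: sum_lessThan_telescope)
  from tendsto_add[OF this tendsto_const[of "u 0"]]
  obtain L where L: "u \<longlonglongrightarrow> L"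
    by auto
  show ?thesis
  proof
    fix j
    have "(\<lambda>n. \<bar>u (j + n) - u j\<bar>) \<longlonglongrightarrow> \<bar>L - u j\<bar>"
      using LIMSEQ_ignore_initial_segment[OF L, of j]
      by (intro tendsto_intros) (simp add: add.commute)
    then show "\<bar>L - u j\<bar> \<le> 4 * e j"
    proof (rule LIMSEQ_le_const2, intro exI allI impI)
      show "\<bar>u (j + n) - u j\<bar> \<le> 4 * e j" for n
        using close[of j n] e_nonneg[of "j + n"] by linarith
    qed
  qed
qed

section \<open>Lattice points away from hyperplanes\<close>

lemma max_abs_component:
  fixes a :: "real ^ 'm"
  obtains k where "\<And>i. \<bar>a $ i\<bar> \<le> \<bar>a $ k\<bar>"
proof -
  have "Max (range (\<lambda>i. \<bar>a $ i\<bar>)) \<in> range (\<lambda>i. \<bar>a $ i\<bar>)"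
    by (intro Max_in) auto
  then obtain k where "Max (range (\<lambda>i. \<bar>a $ i\<bar>)) = \<bar>a $ k\<bar>"
    by (metis (no_types) imageE)
  then show ?thesis
    by (metis Max_ge finite finite_imageI rangeI that)
qed

text \<open>Rounding down gives one lattice point \<open>X p\<close>, and a unit step along the
  coordinate \<open>k\<close> where \<open>a\<close> is largest gives a neighbour
  \<open>X p'\<close>. The values of \<open>a \<bullet> y - d\<close> at the two differ by
  \<open>a $ k / R\<close>, so at one of them the absolute value is at least half of
  \<open>\<bar>a $ k\<bar> / R\<close>. Both points are near \<open>x\<close>, so either may be
  chosen.\<close>

lemma shifted_lattice_point_off_hyperplane:
  fixes a x \<tau> :: "real ^ 'm"
  assumes "R > 0"
  shows "\<exists>x' p. R *\<^sub>R x' = int_vec p + \<tau> \<and> (\<forall>i. \<bar>x' $ i - x $ i\<bar> \<le> 2 / R) \<and>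
           (\<forall>i. \<bar>a $ i\<bar> \<le> 2 * R * \<bar>a \<bullet> x' - d\<bar>)"
proof -
  obtain k where k: "\<And>i. \<bar>a $ i\<bar> \<le> \<bar>a $ k\<bar>"
    using max_abs_component by blast
  define p :: "int ^ 'm" where "p = (\<chi> i. \<lfloor>R * x $ i - \<tau> $ i\<rfloor>)"
  define p' :: "int ^ 'm" where "p' = p + axis k 1"
  define X where "X q = (1 / R) *\<^sub>R (int_vec q + \<tau>)" for q
  have X: "R *\<^sub>R X q = int_vec q + \<tau>" for q
    using assms by (simp add: X_def)
  have near: "\<bar>X q $ i - x $ i\<bar> \<le> 2 / R" if "q $ i = p $ i \<or> q $ i = p $ i + 1" for q i
  proof -
    have "R * (X q $ i - x $ i) = of_int (q $ i) - (R * x $ i - \<tau> $ i)"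
      using assms by (simp add: X_def int_vec_def field_simps)
    moreover have "\<bar>of_int (q $ i) - (R * x $ i - \<tau> $ i)\<bar> \<le> 2"
      using that by (auto simp: p_def) linarith+
    ultimately have "R * \<bar>X q $ i - x $ i\<bar> \<le> 2"
      using assms by (metis abs_mult abs_of_pos)
    then show ?thesis
      using assms by (simp add: field_simps)
  qed
  have "R *\<^sub>R (X p' - X p) = axis k 1"
    unfolding scaleR_diff_right X by (simp add: p'_def int_vec_def vec_eq_iff axis_def)
  then have "R * (a \<bullet> X p' - a \<bullet> X p) = a $ k"
    by (metis cart_eq_inner_axis inner_diff_right inner_scaleR_right)
  then have "\<bar>a $ k\<bar> = R * \<bar>(a \<bullet> X p' - d) - (a \<bullet> X p - d)\<bar>"
    using assms by (metis abs_mult abs_of_pos diff_diff_eq2 diff_add_cancel)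
  also have "\<dots> \<le> R * (\<bar>a \<bullet> X p' - d\<bar> + \<bar>a \<bullet> X p - d\<bar>)"
    using assms by (intro mult_left_mono) auto
  finally have "\<bar>a $ k\<bar> \<le> R * \<bar>a \<bullet> X p' - d\<bar> + R * \<bar>a \<bullet> X p - d\<bar>"
    by (simp add: algebra_simps)
  then consider "\<bar>a $ k\<bar> \<le> 2 * R * \<bar>a \<bullet> X p' - d\<bar>" | "\<bar>a $ k\<bar> \<le> 2 * R * \<bar>a \<bullet> X p - d\<bar>"
    by linarith
  then show ?thesis
  proof cases
    case 1
    have "\<bar>X p' $ i - x $ i\<bar> \<le> 2 / R" for i
      by (rule near) (simp add: p'_def axis_def)
    with 1 show ?thesis
      using X k order_trans by blast
  next
    case 2
    then show ?thesis
      using X k near order_trans by blast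
  qed
qed

text \<open>Step \<open>j\<close> moves the current point to a nearby point with
  \<open>B ^ P j\<close> times it in the integer lattice shifted by \<open>\<tau> j\<close>, and
  away from the hyperplane with index \<open>j\<close>. The gaps in \<open>P\<close> make all later
  moves together so small that they keep the approximation and cannot lead back to that
  hyperplane.\<close>

lemma prescribed_approximation_off_hyperplanes:
  fixes \<tau> a :: "nat \<Rightarrow> real ^ 'm" and d :: "nat \<Rightarrow> real" and B :: real and P :: "nat \<Rightarrow> nat"
  assumes "B \<ge> 2" and G: "2 ^ G > 8 * real CARD('m)"
    and gap: "\<And>j. P j + G \<le> P (Suc j)" and a: "\<And>j. a j \<noteq> 0"
  obtains x where "\<And>j. a j \<bullet> x \<noteq> d j"
    and "\<And>j. \<exists>p. \<forall>i. \<bar>(B ^ P j *\<^sub>R x - int_vec p - \<tau> j) $ i\<bar> \<le> 4 * B ^ P j / B ^ P (Suc j)"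
proof -
  define e where "e j = 1 / B ^ P j" for j
  have B: "B > 0" "B \<ge> 1"
    using assms by auto
  have e_pos: "e j > 0" for j
    using B by (simp add: e_def)
  \<comment> \<open>The factor comes from the hyperplanes: after step \<open>j\<close> each of the
    \<open>CARD('m)\<close> coordinates still moves by at most \<open>4 * e (Suc j)\<close>, while
    the value of the affine functional is only known to be at least half of \<open>e j\<close> times
    the largest coefficient.\<close>
  have e_gap: "8 * real CARD('m) * e (Suc j) < e j" for j
  proof -
    have "8 * real CARD('m) * B ^ P j < 2 ^ G * B ^ P j"
      using G B by simp
    also have "\<dots> \<le> B ^ G * B ^ P j"
      using assms B by (intro mult_right_mono power_mono) auto
    also have "\<dots> = B ^ (P j + G)"
      by (simp add: power_add mult.commute)
    also have "\<dots> \<le> B ^ P (Suc j)"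
      using gap B by (intro power_increasing) auto
    finally show ?thesis
      using B by (simp add: e_def field_simps)
  qed
  have half: "e (Suc j) \<le> e j / 2" for j
  proof -
    have "1 * e (Suc j) \<le> real CARD('m) * e (Suc j)"
      using e_pos[of "Suc j"] by (intro mult_right_mono) (auto simp: Suc_le_eq)
    with e_gap[of j] e_pos[of "Suc j"] show ?thesis
      by linarith
  qed
  define good where "good j x x' \<longleftrightarrow> (\<exists>p. B ^ P j *\<^sub>R x' = int_vec p + \<tau> j) \<and>
      (\<forall>i. \<bar>x' $ i - x $ i\<bar> \<le> 2 * e j) \<and> (\<forall>i. \<bar>a j $ i\<bar> * e j \<le> 2 * \<bar>a j \<bullet> x' - d j\<bar>)"
    for j and x x' :: "real ^ 'm"
  have "\<exists>x'. good j x x'" for j x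
    using shifted_lattice_point_off_hyperplane[of "B ^ P j" "\<tau> j" x "a j" "d j"] B
    by (simp add: good_def e_def field_simps)
  \<comment> \<open>Since \<open>good j\<close> relates the point before step \<open>j\<close> to
    the point after it, the conditions for index \<open>j\<close> hold at \<open>X (Suc j)\<close>;
    the starting point is arbitrary.\<close>
  then obtain X where X: "\<And>j. good j (X j) (X (Suc j))"
    using dependent_nat_choice[of "\<lambda>_ _. True" good] by auto
  have "\<exists>L. \<forall>j. \<bar>L - X j $ i\<bar> \<le> 4 * e j" for i
  proof -
    have "\<bar>X (Suc j) $ i - X j $ i\<bar> \<le> 2 * e j" for j
      using X[of j] by (auto simp: good_def)
    from limit_of_halving_increments[of "\<lambda>j. X j $ i", OF this half] show ?thesis
      by metis
  qed
  then obtain L where L: "\<And>i j. \<bar>L i - X j $ i\<bar> \<le> 4 * e j"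
    by metis
  define x :: "real ^ 'm" where "x = (\<chi> i. L i)"
  have x: "\<bar>x $ i - X j $ i\<bar> \<le> 4 * e j" for i j
    using L by (simp add: x_def)
  show ?thesis
  proof
    show "a j \<bullet> x \<noteq> d j" for j
    proof
      assume eq: "a j \<bullet> x = d j"
      obtain k where k: "\<And>i. \<bar>a j $ i\<bar> \<le> \<bar>a j $ k\<bar>"
        using max_abs_component by blast
      with a[of j] have "a j $ k \<noteq> 0"
        by (auto simp: vec_eq_iff)
      \<comment> \<open>If the limit lay on the hyperplane, the deviation at
        \<open>X (Suc j)\<close> would come entirely from the remaining moves.\<close>
      have "\<bar>a j $ k\<bar> * e j \<le> 2 * \<bar>a j \<bullet> (x - X (Suc j))\<bar>"
        using X[of j] eq by (auto simp: good_def inner_diff_right abs_minus_commute)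
      also have "\<bar>a j \<bullet> (x - X (Suc j))\<bar> \<le> (\<Sum>i\<in>UNIV. \<bar>a j $ i\<bar> * \<bar>x $ i - X (Suc j) $ i\<bar>)"
        unfolding inner_vec_def by (rule order_trans[OF sum_abs]) (simp add: abs_mult)
      also have "\<dots> \<le> (\<Sum>i\<in>(UNIV :: 'm set). \<bar>a j $ k\<bar> * (4 * e (Suc j)))"
        by (intro sum_mono mult_mono k x) auto
      finally have "\<bar>a j $ k\<bar> * e j \<le> \<bar>a j $ k\<bar> * (8 * real CARD('m) * e (Suc j))"
        by (simp add: algebra_simps)
      then have "e j \<le> 8 * real CARD('m) * e (Suc j)"
        using \<open>a j $ k \<noteq> 0\<close> by simp
      with e_gap[of j] show False
        by simp
    qed
    show "\<exists>p. \<forall>i. \<bar>(B ^ P j *\<^sub>R x - int_vec p - \<tau> j) $ i\<bar> \<le> 4 * B ^ P j / B ^ P (Suc j)" for j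
    proof -
      obtain p where p: "B ^ P j *\<^sub>R X (Suc j) = int_vec p + \<tau> j"
        using X[of j] by (auto simp: good_def)
      have "\<bar>(B ^ P j *\<^sub>R x - int_vec p - \<tau> j) $ i\<bar> \<le> 4 * B ^ P j / B ^ P (Suc j)" for i
      proof -
        have "B ^ P j *\<^sub>R x - int_vec p - \<tau> j = B ^ P j *\<^sub>R (x - X (Suc j))"
          using p by (simp add: algebra_simps)
        then have "\<bar>(B ^ P j *\<^sub>R x - int_vec p - \<tau> j) $ i\<bar> = B ^ P j * \<bar>x $ i - X (Suc j) $ i\<bar>"
          using B by (simp add: abs_mult)
        also have "\<dots> \<le> B ^ P j * (4 * e (Suc j))"
          using B by (intro mult_left_mono x) auto
        finally show ?thesis
          by (simp add: e_def mult.commute)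
      qed
      then show ?thesis
        by blast
    qed
  qed
qed

section \<open>From a sequence of exponents to uniform approximation\<close>

text \<open>For \<open>Q\<close> between two consecutive powers with exponents \<open>N k\<close>
  and \<open>N (Suc k)\<close>, the denominator with exponent \<open>N k\<close> serves. Its error
  has to be compared with \<open>Q powr (- v)\<close> at the far end of that range, which explains
  \<open>N (Suc k)\<close> in \<open>lim\<close>. Divergence there absorbs every constant
  factor.\<close>

lemma unif_approx_baseI:
  fixes \<nu> :: "real ^ 'm \<Rightarrow> real" and N :: "nat \<Rightarrow> nat" and g :: "nat \<Rightarrow> real"
  assumes \<nu>: "is_norm \<nu>" and b: "b \<ge> 2" and v: "v \<ge> 0"
    and N: "strict_mono N" "\<And>k. N k \<ge> 1"
    and lim: "filterlim (\<lambda>k. g k - v * real (N (Suc k))) at_top sequentially"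
    and approx: "\<And>k. \<exists>p. \<forall>i. \<bar>(real b ^ N k *\<^sub>R x - int_vec p - \<theta>) $ i\<bar> \<le> 4 * real b powr (- g k)"
  shows "x \<in> unif_approx_base b \<nu> \<theta> v"
  unfolding unif_approx_base_def mem_Collect_eq
proof (intro allI impI)
  fix c :: real assume "c > 0"
  obtain D where D: "D > 0" "\<And>u e. (\<And>i. \<bar>u $ i\<bar> \<le> e) \<Longrightarrow> \<nu> u \<le> D * e"
    using is_norm_bounded_by_components[OF \<nu>] by metis
  have B: "real b > 1"
    using b by simp
  \<comment> \<open>This threshold is the logarithmic form of: \<open>4 * D\<close> times the error
    bound's power of \<open>b\<close> is at most \<open>c\<close> times the power with exponent
    \<open>- v * N (Suc k)\<close>.\<close>
  have "eventually (\<lambda>k. log b (4 * D / c) \<le> g k - v * real (N (Suc k))) sequentially"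
    using lim by (simp add: filterlim_at_top)
  then obtain K where K: "\<And>k. k \<ge> K \<Longrightarrow> log b (4 * D / c) \<le> g k - v * real (N (Suc k))"
    by (auto simp: eventually_sequentially)
  show "\<exists>Q\<^sub>0::real. \<forall>Q\<ge>Q\<^sub>0. \<exists>(q::int) (p::int ^ 'm).
           (\<exists>N::nat. 1 \<le> N \<and> q = int b ^ N) \<and> 1 \<le> q \<and> real_of_int q \<le> Q \<and>
           \<nu> (real_of_int q *\<^sub>R x - int_vec p - \<theta>) \<le> c * Q powr (- v)"
  proof (intro exI[of _ "real b ^ N K"] allI impI)
    fix Q :: real assume Q: "Q \<ge> real b ^ N K"
    \<comment> \<open>The greatest index exists because \<open>N k \<ge> k\<close> for a strictly
      increasing sequence, so \<open>n\<close> bounds all candidates. By maximality \<open>Q\<close>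
      lies below the next power.\<close>
    define k where "k = (GREATEST k. real b ^ N k \<le> Q)"
    obtain n where n: "Q < real b ^ n"
      using real_arch_pow[OF B] by blast
    have bound: "k \<le> n" if "real b ^ N k \<le> Q" for k
    proof -
      have "real b ^ N k < real b ^ n"
        using that n by simp
      then have "N k < n"
        using B by simp
      then show ?thesis
        using strict_mono_imp_increasing[OF N(1), of k] by linarith
    qed
    have k: "real b ^ N k \<le> Q" "K \<le> k"
      unfolding k_def using Q bound GreatestI_nat[of "\<lambda>k. real b ^ N k \<le> Q" K n]
        Greatest_le_nat[of "\<lambda>k. real b ^ N k \<le> Q" K n] by auto
    have "Q < real b ^ N (Suc k)"
      using bound Greatest_le_nat[of "\<lambda>k. real b ^ N k \<le> Q" "Suc k" n]
      unfolding k_def by (metis not_less Suc_n_not_le_n)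
    obtain p where p: "\<And>i. \<bar>(real b ^ N k *\<^sub>R x - int_vec p - \<theta>) $ i\<bar> \<le> 4 * real b powr (- g k)"
      using approx by blast
    have Qpos: "Q > 0"
      using k(1) B by (smt (verit) zero_less_power)
    have "4 * D / c \<le> real b powr (g k - v * real (N (Suc k)))"
      using K[OF k(2)] B D(1) \<open>c > 0\<close> by (subst (asm) log_le_iff) auto
    then have "4 * D \<le> c * (real b powr g k * real b powr (- (v * real (N (Suc k)))))"
      using \<open>c > 0\<close> by (simp add: field_simps flip: powr_add)
    then have "4 * D * real b powr (- g k) \<le> c * real b powr (- (v * real (N (Suc k))))"
      using B by (simp add: powr_minus field_simps)
    also have "real b powr (- (v * real (N (Suc k)))) = (real b ^ N (Suc k)) powr (- v)"
      using B by (simp add: powr_powr mult.commute flip: powr_realpow)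
    also have "\<dots> \<le> Q powr (- v)"
      using \<open>Q < real b ^ N (Suc k)\<close> Qpos v by (intro powr_mono2') auto
    finally have "D * (4 * real b powr (- g k)) \<le> c * Q powr (- v)"
      using \<open>c > 0\<close> by (simp add: algebra_simps)
    moreover have "\<nu> (real b ^ N k *\<^sub>R x - int_vec p - \<theta>) \<le> D * (4 * real b powr (- g k))"
      by (intro D p)
    ultimately have "\<nu> (real_of_int (int b ^ N k) *\<^sub>R x - int_vec p - \<theta>) \<le> c * Q powr (- v)"
      by simp
    moreover have "1 \<le> int b ^ N k"
      using b by (simp add: one_le_power)
    ultimately show "\<exists>(q::int) (p::int ^ 'm). (\<exists>N::nat. 1 \<le> N \<and> q = int b ^ N) \<and>
        1 \<le> q \<and> real_of_int q \<le> Q \<and> \<nu> (real_of_int q *\<^sub>R x - int_vec p - \<theta>) \<le> c * Q powr (- v)"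
      using N(2) k(1) by (intro exI[of _ "int b ^ N k"] exI[of _ p]) auto
  qed
qed

section \<open>The choice of exponents\<close>

text \<open>Before rounding, the exponents are \<open>r ^ k\<close> and \<open>r ^ k / t\<close>. As
  \<open>1 / t - 1 = s / t = w * r\<close>, the first gap is exactly \<open>w\<close> times the next
  \<open>N\<close>; as \<open>r - 1 / t = 1 / s = t * r\<close>, the second is exactly
  \<open>t\<^sup>2 = w'\<close> times the next \<open>M\<close>. The strict inequalities for
  \<open>w\<^sub>0\<close> and \<open>w\<^sub>1\<close> therefore leave a positive multiple of
  \<open>r ^ k\<close>.\<close>

lemma interleaved_exponents:
  fixes w w\<^sub>0 w\<^sub>1 :: real
  assumes w: "0 < w" "w < 1" and w0: "0 \<le> w\<^sub>0" "w\<^sub>0 < w" and w1: "0 \<le> w\<^sub>1" "w\<^sub>1 < (1 - sqrt w)\<^sup>2"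
  obtains N M :: "nat \<Rightarrow> nat"
  where "\<And>k. N k \<ge> 1" "\<And>k. M k \<ge> 1"
    and "filterlim (\<lambda>k. real (M k) - real (N k) - w\<^sub>0 * real (N (Suc k))) at_top sequentially"
    and "filterlim (\<lambda>k. real (N (Suc k)) - real (M k) - w\<^sub>1 * real (M (Suc k))) at_top sequentially"
proof -
  define s t where "s = sqrt w" and "t = 1 - s"
  have s: "0 < s" "s < 1" "w = s\<^sup>2"
    using w by (auto simp: s_def)
  have t: "0 < t" "t < 1" "w\<^sub>1 < t\<^sup>2"
    using s(1,2) w1(2) by (simp_all add: t_def) (simp add: s_def)
  define r where "r = 1 / (s * t)"
  have "s * t < 1"
    using s t by (smt (verit) mult_less_cancel_left2)
  then have r: "r > 1"
    using s t by (simp add: r_def)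
  define N where "N k = nat \<lceil>r ^ k\<rceil>" for k
  define M where "M k = nat \<lceil>r ^ k / t\<rceil>" for k
  have N: "r ^ k \<le> real (N k)" "real (N k) \<le> r ^ k + 1" for k
    using r zero_less_power[of r k] unfolding N_def by linarith+
  have M: "r ^ k / t \<le> real (M k)" "real (M k) \<le> r ^ k / t + 1" for k
    using r t divide_pos_pos[OF zero_less_power[of r k], of t] unfolding M_def by linarith+
  have lim: "filterlim (\<lambda>k. A * r ^ k - C) at_top sequentially" if "A > 0" for A C :: real
  proof -
    have "filterlim (\<lambda>k. r ^ k) at_top sequentially"
      using filterlim_realpow_sequentially_gt1[of r] r
      by (intro filterlim_at_infinity_imp_filterlim_at_top) auto
    then have "filterlim (\<lambda>k. - C + A * r ^ k) at_top sequentially"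
      using that by (intro filterlim_tendsto_add_at_top[OF tendsto_const]
        filterlim_tendsto_pos_mult_at_top[OF tendsto_const])
    then show ?thesis
      by simp
  qed
  show ?thesis
  proof
    have "0 < r ^ k" for k
      using r by simp
    then show "N k \<ge> 1" "M k \<ge> 1" for k
      using less_le_trans[OF _ N(1)[of k], of 0] less_le_trans[OF _ M(1)[of k], of 0] t
      by (simp_all add: Suc_le_eq)
    show "filterlim (\<lambda>k. real (M k) - real (N k) - w\<^sub>0 * real (N (Suc k))) at_top sequentially"
    proof (rule filterlim_at_top_mono[OF lim])
      show "(w - w\<^sub>0) * r > 0"
        using w0 r by simp
      \<comment> \<open>Rounding up costs at most 1 through \<open>N k\<close> and at most
        \<open>w\<^sub>0\<close> through \<open>N (Suc k)\<close>; rounding \<open>M k\<close> up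
        only helps.\<close>
      have "(w - w\<^sub>0) * r * r ^ k - (1 + w\<^sub>0) \<le> real (M k) - real (N k) - w\<^sub>0 * real (N (Suc k))" for k
      proof -
        have "1 + w * r = 1 / t"
          using s t by (simp add: r_def power2_eq_square field_simps) (simp add: t_def)
        then have "r ^ k / t = r ^ k + w * r * r ^ k"
          by (metis add_mult_distrib2 distrib_right mult.left_neutral times_divide_eq_left)
        moreover have "w\<^sub>0 * real (N (Suc k)) \<le> w\<^sub>0 * (r * r ^ k + 1)"
          using N(2)[of "Suc k"] w0 by (intro mult_left_mono) auto
        ultimately show ?thesis
          using M(1)[of k] N(2)[of k] by (simp add: algebra_simps)
      qed
      then show "\<forall>\<^sub>F k in sequentially.
          (w - w\<^sub>0) * r * r ^ k - (1 + w\<^sub>0) \<le> real (M k) - real (N k) - w\<^sub>0 * real (N (Suc k))"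
        by simp
    qed
    show "filterlim (\<lambda>k. real (N (Suc k)) - real (M k) - w\<^sub>1 * real (M (Suc k))) at_top sequentially"
    proof (rule filterlim_at_top_mono[OF lim])
      show "(t\<^sup>2 - w\<^sub>1) * (r / t) > 0"
        using t r by simp
      have "(t\<^sup>2 - w\<^sub>1) * (r / t) * r ^ k - (1 + w\<^sub>1)
          \<le> real (N (Suc k)) - real (M k) - w\<^sub>1 * real (M (Suc k))" for k
      proof -
        have "r = 1 / t + t\<^sup>2 * (r / t)"
          using s t by (simp add: r_def power2_eq_square field_simps) (simp add: t_def)
        then have "r * r ^ k = r ^ k / t + t\<^sup>2 * (r / t) * r ^ k"
          by (metis distrib_right mult.left_neutral times_divide_eq_left)
        moreover have "w\<^sub>1 * real (M (Suc k)) \<le> w\<^sub>1 * (r * r ^ k / t + 1)"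
          using M(2)[of "Suc k"] w1 by (intro mult_left_mono) auto
        moreover have "w\<^sub>1 * (r * r ^ k / t + 1) = w\<^sub>1 * (r / t) * r ^ k + w\<^sub>1"
          by (simp add: distrib_left)
        ultimately show ?thesis
          using N(1)[of "Suc k"] M(2)[of k] unfolding power_Suc left_diff_distrib by linarith
      qed
      then show "\<forall>\<^sub>F k in sequentially. (t\<^sup>2 - w\<^sub>1) * (r / t) * r ^ k - (1 + w\<^sub>1)
          \<le> real (N (Suc k)) - real (M k) - w\<^sub>1 * real (M (Suc k))"
        by simp
    qed
  qed
qed

section \<open>Splitting a vector into a sum\<close>

text \<open>Conditions on \<open>x\<close> and on \<open>z - x\<close> are all turned into
  conditions on \<open>x\<close> alone, so that a single limit construction along the merged
  exponents satisfies them together.\<close>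

lemma sum_of_base_sets_off_hyperplanes:
  fixes \<nu> :: "real ^ 'm \<Rightarrow> real" and z :: "real ^ 'm" and w :: real
  assumes \<nu>: "is_norm \<nu>" and b: "b \<ge> 2" and w: "0 < w" "w < 1"
    and w0: "0 \<le> w\<^sub>0" "w\<^sub>0 < w" and w1: "0 \<le> w\<^sub>1" "w\<^sub>1 < (1 - sqrt w)\<^sup>2"
    and countable: "countable \<H>" and hyp: "\<And>H. H \<in> \<H> \<Longrightarrow> affine_hyperplane H"
  shows "z \<in> (unif_approx_base b \<nu> \<theta>\<^sub>0 w\<^sub>0 - \<Union>\<H>) + (unif_approx_base b \<nu> \<theta>\<^sub>1 w\<^sub>1 - \<Union>\<H>)"
proof -
  obtain G :: nat where G: "2 ^ G > 8 * real CARD('m)"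
    using real_arch_pow[of 2] by auto
  obtain N' M' :: "nat \<Rightarrow> nat" where pos': "\<And>k. N' k \<ge> 1" "\<And>k. M' k \<ge> 1"
    and limN': "filterlim (\<lambda>k. real (M' k) - real (N' k) - w\<^sub>0 * real (N' (Suc k))) at_top sequentially"
    and limM': "filterlim (\<lambda>k. real (N' (Suc k)) - real (M' k) - w\<^sub>1 * real (M' (Suc k))) at_top sequentially"
    by (rule interleaved_exponents[OF w w0 w1]) (rule that)
  have "\<forall>\<^sub>F k in sequentially. real G + 1 \<le> real (M' k) - real (N' k) - w\<^sub>0 * real (N' (Suc k)) \<and>
      real G + 1 \<le> real (N' (Suc k)) - real (M' k) - w\<^sub>1 * real (M' (Suc k))"
    using limN' limM' by (auto simp: filterlim_at_top intro: eventually_conj)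
  then obtain K where K: "\<And>k. k \<ge> K \<Longrightarrow>
      real G + 1 \<le> real (M' k) - real (N' k) - w\<^sub>0 * real (N' (Suc k)) \<and>
      real G + 1 \<le> real (N' (Suc k)) - real (M' k) - w\<^sub>1 * real (M' (Suc k))"
    by (auto simp: eventually_sequentially)
  \<comment> \<open>Dropping the first \<open>K\<close> indices keeps the limits and makes every gap
    large enough for the limit construction.\<close>
  define N M where "N k = N' (k + K)" and "M k = M' (k + K)" for k
  have pos: "N k \<ge> 1" "M k \<ge> 1" for k
    using pos' by (auto simp: N_def M_def)
  have limN: "filterlim (\<lambda>k. (real (M k) - real (N k)) - w\<^sub>0 * real (N (Suc k))) at_top sequentially"
    and limM: "filterlim (\<lambda>k. (real (N (Suc k)) - real (M k)) - w\<^sub>1 * real (M (Suc k))) at_top sequentially"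
    using filterlim_compose[OF limN' filterlim_add_const_nat_at_top[of K]]
      filterlim_compose[OF limM' filterlim_add_const_nat_at_top[of K]]
    by (simp_all add: N_def M_def)
  have gapNM: "N k + G + 1 \<le> M k" and gapMN: "M k + G + 1 \<le> N (Suc k)" for k
  proof -
    have "0 \<le> w\<^sub>0 * real (N (Suc k))" "0 \<le> w\<^sub>1 * real (M (Suc k))"
      using w0 w1 by auto
    with K[of "k + K"] show "N k + G + 1 \<le> M k" "M k + G + 1 \<le> N (Suc k)"
      by (simp_all add: N_def M_def)
  qed
  define P where "P j = (if even j then N (j div 2) else M (j div 2))" for j
  have P: "P (2 * k) = N k" "P (Suc (2 * k)) = M k" "P (Suc (Suc (2 * k))) = N (Suc k)" for k
    by (simp_all add: P_def)
  have gap: "P j + G \<le> P (Suc j)" for j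
    using gapNM[of "j div 2"] gapMN[of "j div 2"] by (cases "even j") (auto simp: P_def elim!: oddE)
  have "\<exists>a d. a \<noteq> 0 \<and> (\<forall>y. y \<in> H \<longleftrightarrow> a \<bullet> y = d)" if "H \<in> \<H>" for H
    using hyp[OF that] by (auto simp: affine_hyperplane_def)
  then obtain n d where nd: "\<And>H. H \<in> \<H> \<Longrightarrow> n H \<noteq> 0"
    "\<And>H y. H \<in> \<H> \<Longrightarrow> y \<in> H \<longleftrightarrow> n H \<bullet> y = d H"
    by metis
  \<comment> \<open>Pairs of normal vector and offset. The second family encodes the reflected
    hyperplanes: \<open>z - x\<close> lies on \<open>n \<bullet> y = d\<close> iff
    \<open>n \<bullet> x = n \<bullet> z - d\<close>. The extra pair keeps \<open>Z\<close>
    nonempty, so that \<open>from_nat_into\<close> enumerates it even without hyperplanes.\<close>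
  define Z where "Z = insert (axis undefined 1, 0)
    ((\<lambda>H. (n H, d H)) ` \<H> \<union> (\<lambda>H. (n H, n H \<bullet> z - d H)) ` \<H>)"
  have Z: "countable Z" "Z \<noteq> {}"
    using countable by (auto simp: Z_def)
  have Z_normal: "fst h \<noteq> 0" if "h \<in> Z" for h
    using that nd by (auto simp: Z_def axis_eq_0_iff)
  define a c where "a j = fst (from_nat_into Z j)" and "c j = snd (from_nat_into Z j)" for j
  have a: "a j \<noteq> 0" for j
    using Z_normal from_nat_into[OF Z(2)] by (simp add: a_def)
  \<comment> \<open>At odd indices, \<open>x\<close> scaled by the power of \<open>b\<close> being
    close to this target modulo integers means that \<open>z - x\<close> scaled likewise is close to
    \<open>\<theta>\<^sub>1\<close>, with the integer vector negated.\<close>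
  define \<tau> where "\<tau> j = (if even j then \<theta>\<^sub>0 else real b ^ P j *\<^sub>R z - \<theta>\<^sub>1)" for j
  have B: "real b \<ge> 2"
    using b by simp
  obtain x where off: "\<And>j. a j \<bullet> x \<noteq> c j"
    and near: "\<And>j. \<exists>p. \<forall>i. \<bar>(real b ^ P j *\<^sub>R x - int_vec p - \<tau> j) $ i\<bar>
                 \<le> 4 * real b ^ P j / real b ^ P (Suc j)"
    using prescribed_approximation_off_hyperplanes[where a = a and d = c and \<tau> = \<tau> and P = P, OF B G gap a]
    by metis
  have powr_eq: "4 * real b ^ i / real b ^ j = 4 * real b powr (- (real j - real i))" for i j
    using b by (simp add: powr_diff powr_realpow)
  have off_Z: "h \<in> Z \<Longrightarrow> fst h \<bullet> x \<noteq> snd h" for h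
    using off from_nat_into_surj[OF Z(1)] unfolding a_def c_def by metis
  have "x \<notin> \<Union>\<H>"
  proof
    assume "x \<in> \<Union>\<H>"
    then obtain H where "H \<in> \<H>" "x \<in> H"
      by blast
    then show False
      using off_Z[of "(n H, d H)"] nd(2)[of H x] by (auto simp: Z_def)
  qed
  moreover have "z - x \<notin> \<Union>\<H>"
  proof
    assume "z - x \<in> \<Union>\<H>"
    then obtain H where "H \<in> \<H>" "z - x \<in> H"
      by blast
    then show False
      using off_Z[of "(n H, n H \<bullet> z - d H)"] nd(2)[of H "z - x"] by (auto simp: Z_def inner_diff_right)
  qed
  moreover have "x \<in> unif_approx_base b \<nu> \<theta>\<^sub>0 w\<^sub>0"
  proof (rule unif_approx_baseI[OF \<nu> b w0(1) _ pos(1) limN])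
    show "strict_mono N"
      unfolding strict_mono_Suc_iff using gapNM gapMN
      by (metis Suc_eq_plus1 Suc_le_eq add_lessD1 less_trans)
    show "\<exists>p. \<forall>i. \<bar>(real b ^ N k *\<^sub>R x - int_vec p - \<theta>\<^sub>0) $ i\<bar> \<le> 4 * real b powr (- (real (M k) - real (N k)))" for k
      using near[of "2 * k"] unfolding P powr_eq by (simp add: \<tau>_def)
  qed
  moreover have "z - x \<in> unif_approx_base b \<nu> \<theta>\<^sub>1 w\<^sub>1"
  proof (rule unif_approx_baseI[OF \<nu> b w1(1) _ pos(2) limM])
    show "strict_mono M"
      unfolding strict_mono_Suc_iff using gapNM gapMN
      by (metis Suc_eq_plus1 Suc_le_eq add_lessD1 less_trans)
    show "\<exists>p. \<forall>i. \<bar>(real b ^ M k *\<^sub>R (z - x) - int_vec p - \<theta>\<^sub>1) $ i\<bar>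
        \<le> 4 * real b powr (- (real (N (Suc k)) - real (M k)))" for k
    proof -
      obtain p where p: "\<And>i. \<bar>(real b ^ M k *\<^sub>R x - int_vec p - (real b ^ M k *\<^sub>R z - \<theta>\<^sub>1)) $ i\<bar>
          \<le> 4 * real b powr (- (real (N (Suc k)) - real (M k)))"
        using near[of "Suc (2 * k)"] unfolding P powr_eq by (auto simp: \<tau>_def P)
      have "real b ^ M k *\<^sub>R (z - x) - int_vec (- p) - \<theta>\<^sub>1
          = - (real b ^ M k *\<^sub>R x - int_vec p - (real b ^ M k *\<^sub>R z - \<theta>\<^sub>1))"
        by (simp add: vec_eq_iff int_vec_def algebra_simps)
      then have "\<bar>(real b ^ M k *\<^sub>R (z - x) - int_vec (- p) - \<theta>\<^sub>1) $ i\<bar>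
          \<le> 4 * real b powr (- (real (N (Suc k)) - real (M k)))" for i
        using p[of i] by (simp only: vector_uminus_component abs_minus_cancel)
      then show ?thesis
        by blast
    qed
  qed
  ultimately have "x + (z - x) \<in> (unif_approx_base b \<nu> \<theta>\<^sub>0 w\<^sub>0 - \<Union>\<H>) + (unif_approx_base b \<nu> \<theta>\<^sub>1 w\<^sub>1 - \<Union>\<H>)"
    by (intro set_plus_intro) auto
  then show ?thesis
    by simp
qed

lemma unif_approx_base_subset: "unif_approx_base b \<nu> \<theta> v \<subseteq> unif_approx \<nu> \<theta> v"
  unfolding unif_approx_base_def unif_approx_def by blast

theorem theorem3p1:
  fixes \<nu> :: "real ^ 'm \<Rightarrow> real"
    and b :: nat
    and \<theta>\<^sub>0 \<theta>\<^sub>1 :: "real ^ 'm"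
    and w w' w\<^sub>0 w\<^sub>1 :: real
  assumes "is_norm \<nu>"
    and "b \<ge> 2"
    and "0 < w" and "w < 1"
    and "w' = (1 - sqrt w)\<^sup>2"
    and "0 \<le> w\<^sub>0" and "w\<^sub>0 < w"
    and "0 \<le> w\<^sub>1" and "w\<^sub>1 < w'"
  shows "unif_approx_base b \<nu> \<theta>\<^sub>0 w\<^sub>0 + unif_approx_base b \<nu> \<theta>\<^sub>1 w\<^sub>1
           = unif_approx \<nu> \<theta>\<^sub>0 w\<^sub>0 + unif_approx \<nu> \<theta>\<^sub>1 w\<^sub>1
       \<and> unif_approx \<nu> \<theta>\<^sub>0 w\<^sub>0 + unif_approx \<nu> \<theta>\<^sub>1 w\<^sub>1 = UNIV
       \<and> (\<forall>\<H>. countable \<H> \<and> (\<forall>H\<in>\<H>. affine_hyperplane H) \<longrightarrow>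
            full_lebesgue_measure
              ((unif_approx_base b \<nu> \<theta>\<^sub>0 w\<^sub>0 - \<Union>\<H>) + (unif_approx_base b \<nu> \<theta>\<^sub>1 w\<^sub>1 - \<Union>\<H>)) \<and>
            full_lebesgue_measure
              ((unif_approx \<nu> \<theta>\<^sub>0 w\<^sub>0 - \<Union>\<H>) + (unif_approx \<nu> \<theta>\<^sub>1 w\<^sub>1 - \<Union>\<H>)))"
proof -
  have base: "(unif_approx_base b \<nu> \<theta>\<^sub>0 w\<^sub>0 - \<Union>\<H>) + (unif_approx_base b \<nu> \<theta>\<^sub>1 w\<^sub>1 - \<Union>\<H>) = UNIV"
    if "countable \<H>" "\<And>H. H \<in> \<H> \<Longrightarrow> affine_hyperplane H" for \<H>
    using sum_of_base_sets_off_hyperplanes[of \<nu> b w w\<^sub>0 w\<^sub>1 \<H>] assms that by blast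
  \<comment> \<open>Enlarging both summands from the \<open>b\<close>-ary sets can only enlarge a
    sum that is already everything.\<close>
  have all: "(unif_approx \<nu> \<theta>\<^sub>0 w\<^sub>0 - \<Union>\<H>) + (unif_approx \<nu> \<theta>\<^sub>1 w\<^sub>1 - \<Union>\<H>) = UNIV"
    if "countable \<H>" "\<And>H. H \<in> \<H> \<Longrightarrow> affine_hyperplane H" for \<H>
    using base[OF that] set_plus_mono2[OF Diff_mono[OF unif_approx_base_subset order_refl]
        Diff_mono[OF unif_approx_base_subset order_refl]]
    by (metis top.extremum_uniqueI)
  have "full_lebesgue_measure (UNIV :: (real ^ 'm) set)"
    by (simp add: full_lebesgue_measure_def)
  \<comment> \<open>The empty family of hyperplanes yields the two equalities; for general families
    the complement is empty, hence null.\<close>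
  with base all base[of "{}"] all[of "{}"] show ?thesis
    by simp
qed

end
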